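(* Assume that both $S$ and $D$ are invertible. Then for all $i,j\in\{1,\dots,m+1\}$ the matrices $A_i$ and $B_j$ are invertible, and the following identities hold: $$A_i^{-1}A_j = B_i^{-1}B_j,$$ or equivalently $$A_j B_j^{-1} = A_i B_i^{-1}.$$
   Context: Let $m\ge 1$ be an integer and let $d_1,\dots,d_{m+1}$ and $n_1,\dots,n_{m+1}$ be nonzero real numbers. Define $m\times m$ real triangular Toeplitz matrices as follows. $D_L$ is lower triangular with $(p,q)$ entry $d_{p-q+1}$ if $p\ge q$ and $0$ if $p<q$ (so $d_1$ is on the diagonal and the first column is $(d_1,\dots,d_m)^T$). $D_U$ is upper triangular with $(p,q)$ entry $d_{m+1-(q-p)}$ if $q\ge p$ and $0$ if $q<p$ (so $d_{m+1}$ is on the diagonal and the first row is $(d_{m+1},d_m,\dots,d_2)$). $N_L$ and $N_U$ are defined in the same way with $n_k$ in place of $d_k$. Define the $2m\times 2m$ block matrices $$S=\begin{pmatrix} D_L & N_L\\ D_U & N_U\end{pmatrix},\qquad D=\begin{pmatrix} D_L & 0\\ D_U & D_L\end{pmatrix}.$$ When $S$ and $D$ are invertible, put $A=D^{-1}$ and $B=S^{-1}$. Let $A_B$ (respectively $B_B$) be the $m\times 2m$ matrix consisting of the last $m$ rows of $A$ (respectively $B$). For $1\le i\le m+1$, $A_i$ (respectively $B_i$) denotes the $m\times m$ submatrix of $A_B$ (respectively $B_B$) consisting of its $m$ consecutive columns $i,i+1,\dots,i+m-1$. *)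

theory Defs
  imports
    "Jordan_Normal_Form.Gauss_Jordan_Elimination"
    "Jordan_Normal_Form.DL_Submatrix"
begin

text \<open>The matrices of this library are indexed from 0, whereas the coefficients
  \<open>c 1, \<dots>, c (m + 1)\<close> and the windows \<open>1, \<dots>, m + 1\<close> are numbered from 1.\<close>

definition lower_toeplitz :: "nat \<Rightarrow> (nat \<Rightarrow> real) \<Rightarrow> real mat" where
  "lower_toeplitz m c = mat m m (\<lambda>(p, q). if q \<le> p then c (p - q + 1) else 0)"

definition upper_toeplitz :: "nat \<Rightarrow> (nat \<Rightarrow> real) \<Rightarrow> real mat" where
  "upper_toeplitz m c = mat m m (\<lambda>(p, q). if p \<le> q then c (m + 1 - (q - p)) else 0)"

definition S_mat :: "nat \<Rightarrow> (nat \<Rightarrow> real) \<Rightarrow> (nat \<Rightarrow> real) \<Rightarrow> real mat" where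
  "S_mat m d n = four_block_mat
     (lower_toeplitz m d) (lower_toeplitz m n)
     (upper_toeplitz m d) (upper_toeplitz m n)"

definition D_mat :: "nat \<Rightarrow> (nat \<Rightarrow> real) \<Rightarrow> real mat" where
  "D_mat m d = four_block_mat
     (lower_toeplitz m d) (0\<^sub>m m m)
     (upper_toeplitz m d) (lower_toeplitz m d)"

text \<open>The value is unspecified unless the argument is invertible.\<close>

definition inv_mat :: "real mat \<Rightarrow> real mat" where
  "inv_mat M = the (mat_inverse M)"

lemma inv_mat_inverts:
  assumes "invertible_mat M"
  shows "inverts_mat M (inv_mat M)" "inverts_mat (inv_mat M) M"
proof -
  define n where "n = dim_row M"
  from assms obtain N where sq: "dim_col M = n" and MN: "M * N = 1\<^sub>m n"
    and NM: "N * M = 1\<^sub>m (dim_row N)"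
    unfolding invertible_mat_def inverts_mat_def n_def by auto
  have M: "M \<in> carrier_mat n n" using sq n_def by auto
  have "dim_col N = n" using arg_cong[OF MN, of dim_col] by simp
  moreover have "dim_row N = n" using arg_cong[OF NM, of dim_col] sq by simp
  ultimately have "M \<in> Units (ring_mat TYPE(real) n n)"
    using M MN NM by (auto simp: Units_def ring_mat_simps intro!: bexI[of _ N])
  with mat_inverse(1)[OF M, of n] obtain B where B: "mat_inverse M = Some B"
    by (cases "mat_inverse M") auto
  from mat_inverse(2)[OF M this] M B
  show "inverts_mat M (inv_mat M)" "inverts_mat (inv_mat M) M"
    by (auto simp: inverts_mat_def inv_mat_def)
qed

definition bottom_rows :: "nat \<Rightarrow> real mat \<Rightarrow> real mat" where
  "bottom_rows m M = submatrix M {m..<2 * m} UNIV"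

definition window :: "nat \<Rightarrow> real mat \<Rightarrow> nat \<Rightarrow> real mat" where
  "window m M i = submatrix (bottom_rows m M) UNIV {i - 1..<i - 1 + m}"

end

theory Submission
  imports Defs "Jordan_Normal_Form.Determinant"
begin

text \<open>Both \<open>D\<close> and \<open>S\<close> have the same first \<open>m\<close> columns \<open>C\<close>, a \<open>2m \<times> m\<close> banded Toeplitz matrix.
  The last \<open>m\<close> rows of either inverse annihilate \<open>C\<close> and have rank \<open>m\<close>, so they span the same
  space: \<open>B\<^sub>B = T A\<^sub>B\<close> for some \<open>T\<close>, hence \<open>B\<^sub>i = T A\<^sub>i\<close> for every \<open>i\<close>.
  A vector in the kernel of the window \<open>i\<close> extends by zero to a vector \<open>C w\<close> that
  vanishes outside the window. Above the window \<open>C\<close> is lower triangular with diagonal \<open>d 1\<close>, below it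
  is upper triangular with diagonal \<open>d (m + 1)\<close>, and together these equations force \<open>w = 0\<close>.
  Thus all windows are invertible and both quotients are determined by \<open>T\<close>.\<close>

section \<open>Invertible matrices\<close>

lemma invertible_mat_of_trivial_kernel:
  fixes M :: "'a :: field mat"
  assumes M: "M \<in> carrier_mat n n"
    and ker: "\<And>x. x \<in> carrier_vec n \<Longrightarrow> M *\<^sub>v x = 0\<^sub>v n \<Longrightarrow> x = 0\<^sub>v n"
  shows "invertible_mat M"
proof -
  have "det M \<noteq> 0"
    using det_0_iff_vec_prod_zero_field[OF M] ker by blast
  from det_non_zero_imp_unit[OF M this, of n]
  obtain N where "N \<in> carrier_mat n n" "N * M = 1\<^sub>m n" "M * N = 1\<^sub>m n"
    by (auto simp: Units_def ring_mat_simps)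
  then show ?thesis
    using M by (auto simp: invertible_mat_def inverts_mat_def intro!: exI[of _ N])
qed

lemma inv_mat_props:
  assumes M: "M \<in> carrier_mat n n" and inv: "invertible_mat M"
  shows "inv_mat M \<in> carrier_mat n n" "M * inv_mat M = 1\<^sub>m n" "inv_mat M * M = 1\<^sub>m n"
proof -
  have *: "M * inv_mat M = 1\<^sub>m n" "inv_mat M * M = 1\<^sub>m (dim_row (inv_mat M))"
    using inv_mat_inverts[OF inv] M by (auto simp: inverts_mat_def)
  \<comment> \<open>\<open>inverts_mat\<close> leaves the size of the inverse open, so it is read
    off from the two products.\<close>
  have "dim_col (inv_mat M) = n"
    using arg_cong[OF *(1), of dim_col] by simp
  moreover have "dim_row (inv_mat M) = n"
    using arg_cong[OF *(2), of dim_col] M by simp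
  ultimately show "inv_mat M \<in> carrier_mat n n" "M * inv_mat M = 1\<^sub>m n" "inv_mat M * M = 1\<^sub>m n"
    using * by auto
qed

text \<open>Cancelling \<open>X\<close> on the right of
  \<open>inv_mat (T * X) * T * X = 1\<^sub>m n\<close> gives
  \<open>inv_mat (T * X) * T = inv_mat X\<close>, and both claims follow. The second one exhibits a
  left inverse of \<open>T\<close>.\<close>

lemma left_multiple_quotients:
  assumes c: "T \<in> carrier_mat n n" "X \<in> carrier_mat n n" "Y \<in> carrier_mat n n"
    and X: "invertible_mat X" and TX: "invertible_mat (T * X)"
  shows "inv_mat (T * X) * (T * Y) = inv_mat X * Y"
    and "X * inv_mat (T * X) * T = 1\<^sub>m n"
proof -
  let ?Z = "inv_mat (T * X)"
  note TXc = mult_carrier_mat[OF c(1,2)]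
  note x = inv_mat_props[OF c(2) X] and z = inv_mat_props[OF TXc TX]
  have ZT: "?Z * T \<in> carrier_mat n n"
    using z c by auto
  have ZTX: "?Z * T * X = 1\<^sub>m n"
    unfolding assoc_mult_mat[OF z(1) c(1,2)] by (rule z(3))
  have "?Z * T = ?Z * T * (X * inv_mat X)"
    unfolding x(2) by (rule right_mult_one_mat[OF ZT, symmetric])
  also have "\<dots> = inv_mat X"
    unfolding assoc_mult_mat[OF ZT c(2) x(1), symmetric] ZTX by (rule left_mult_one_mat[OF x(1)])
  finally have ZT_eq: "?Z * T = inv_mat X" .
  show "X * ?Z * T = 1\<^sub>m n"
    unfolding assoc_mult_mat[OF c(2) z(1) c(1)] ZT_eq by (rule x(2))
  show "?Z * (T * Y) = inv_mat X * Y"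
    unfolding assoc_mult_mat[OF z(1) c(1,3), symmetric] ZT_eq by (rule refl)
qed

section \<open>Windows\<close>

lemma pick_atLeastLessThan:
  assumes "k < b"
  shows "pick {a..<a + b} k = a + k"
proof -
  \<comment> \<open>\<open>pick\<close> is evaluated by counting: \<open>a + k\<close> is the
    element of the interval with exactly \<open>k\<close> smaller ones.\<close>
  have "{x \<in> {a..<a + b}. x < a + k} = {a..<a + k}"
    using assms by auto
  then show ?thesis
    using pick_card_in_set[of "a + k" "{a..<a + b}"] assms by simp
qed

lemma
  assumes M: "M \<in> carrier_mat (2 * m) (2 * m)" and i: "i \<in> {1..m + 1}"
  shows window_carrier: "window m M i \<in> carrier_mat m m"
    and index_window: "\<And>p q. p < m \<Longrightarrow> q < m \<Longrightarrow> window m M i $$ (p, q) = M $$ (m + p, i - 1 + q)"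
proof -
  have b: "dim_row (bottom_rows m M) = m" "dim_col (bottom_rows m M) = 2 * m"
  proof -
    have "dim_row (bottom_rows m M) = card {m..<2 * m}"
      unfolding bottom_rows_def dim_submatrix using M by (intro arg_cong[of _ _ card]) auto
    then show "dim_row (bottom_rows m M) = m" by simp
    have "dim_col (bottom_rows m M) = card {..<2 * m}"
      unfolding bottom_rows_def dim_submatrix using M by (intro arg_cong[of _ _ card]) auto
    then show "dim_col (bottom_rows m M) = 2 * m" by simp
  qed
  have w: "dim_row (window m M i) = m" "dim_col (window m M i) = m"
  proof -
    have "dim_row (window m M i) = card {..<m}"
      unfolding window_def dim_submatrix using b by (intro arg_cong[of _ _ card]) auto
    then show "dim_row (window m M i) = m" by simp
    \<comment> \<open>The bound \<open>i \<le> m + 1\<close> keeps all \<open>m\<close> columns of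
      the window inside the \<open>2 * m\<close> columns of \<open>M\<close>.\<close>
    have "dim_col (window m M i) = card {i - 1..<i - 1 + m}"
      unfolding window_def dim_submatrix using b i by (intro arg_cong[of _ _ card]) auto
    then show "dim_col (window m M i) = m" by simp
  qed
  then show "window m M i \<in> carrier_mat m m" by auto
  fix p q assume pq: "p < m" "q < m"
  have "window m M i $$ (p, q) = bottom_rows m M $$ (pick UNIV p, pick {i - 1..<i - 1 + m} q)"
    using pq w unfolding window_def dim_submatrix by (intro submatrix_index) simp_all
  also have "\<dots> = bottom_rows m M $$ (p, i - 1 + q)"
    by (simp only: pick_UNIV pick_atLeastLessThan[OF pq(2)])
  also have "\<dots> = M $$ (pick {m..<2 * m} p, pick UNIV (i - 1 + q))"
  proof -
    have "i - 1 + q < 2 * m" using i pq by auto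
    then show ?thesis
      using pq b unfolding bottom_rows_def dim_submatrix by (intro submatrix_index) simp_all
  qed
  also have "\<dots> = M $$ (m + p, i - 1 + q)"
    by (simp only: pick_UNIV mult_2 pick_atLeastLessThan[OF pq(1)])
  finally show "window m M i $$ (p, q) = M $$ (m + p, i - 1 + q)" .
qed

lemma sum_window:
  fixes f g :: "nat \<Rightarrow> 'a :: semiring_0"
  assumes "s \<le> m"
  shows "(\<Sum>c<2 * m. f c * (if s \<le> c \<and> c < s + m then g (c - s) else 0)) = (\<Sum>q<m. f (s + q) * g q)"
proof -
  have "(\<Sum>c<2 * m. f c * (if s \<le> c \<and> c < s + m then g (c - s) else 0))
      = (\<Sum>c\<in>{0 + s..<m + s}. f c * g (c - s))"
    using assms by (intro sum.mono_neutral_cong_right) auto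
  also have "\<dots> = (\<Sum>q<m. f (s + q) * g q)"
    unfolding sum.shift_bounds_nat_ivl by (simp add: add.commute lessThan_atLeast0)
  finally show ?thesis .
qed

section \<open>The common banded block\<close>

text \<open>One formula for both Toeplitz halves of \<open>C\<close>: column \<open>q\<close>
  carries \<open>d 1\<close>, ..., \<open>d (m + 1)\<close> in rows \<open>q\<close> to
  \<open>q + m\<close>.\<close>

definition band :: "nat \<Rightarrow> (nat \<Rightarrow> real) \<Rightarrow> nat \<Rightarrow> nat \<Rightarrow> real" where
  "band m d r q = (if q \<le> r \<and> r \<le> q + m then d (r - q + 1) else 0)"

text \<open>Forward substitution in the top equations kills the \<open>w q\<close> with
  \<open>q < s\<close>; back substitution in the bottom ones, from the last row upwards, kills those
  with \<open>s \<le> q\<close>. Neither half needs the other.\<close>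

lemma band_kernel_trivial:
  assumes d: "d 1 \<noteq> 0" "d (m + 1) \<noteq> 0"
    and top: "\<And>r. r < s \<Longrightarrow> (\<Sum>q<m. band m d r q * w q) = 0"
    and bot: "\<And>r. s \<le> r \<Longrightarrow> r < m \<Longrightarrow> (\<Sum>q<m. band m d (m + r) q * w q) = 0"
    and q: "q < m"
  shows "w q = 0"
proof -
  have upper: "r < s \<Longrightarrow> r < m \<Longrightarrow> w r = 0" for r
  proof (induction r rule: less_induct)
    case (less r)
    have "(\<Sum>q<m. band m d r q * w q) = (\<Sum>q<m. if q = r then d 1 * w r else 0)"
      using less by (intro sum.cong) (auto simp: band_def not_le)
    then show ?case
      using top less.prems d by simp
  qed
  have lower: "s \<le> r \<Longrightarrow> r < m \<Longrightarrow> w r = 0" for r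
  proof (induction "m - r" arbitrary: r rule: less_induct)
    case less
    have "(\<Sum>q<m. band m d (m + r) q * w q) = (\<Sum>q<m. if q = r then d (m + 1) * w r else 0)"
      using less by (intro sum.cong) (auto simp: band_def not_le)
    then show ?case
      using bot less.prems d by simp
  qed
  show ?thesis
    using upper lower q by (cases "q < s") auto
qed

lemma window_invertible:
  assumes d: "d 1 \<noteq> 0" "d (m + 1) \<noteq> 0"
    and M: "M \<in> carrier_mat (2 * m) (2 * m)" and inv: "invertible_mat M"
    and band: "\<And>r q. r < 2 * m \<Longrightarrow> q < m \<Longrightarrow> M $$ (r, q) = band m d r q"
    and i: "i \<in> {1..m + 1}"
  shows "invertible_mat (window m (inv_mat M) i)"
proof (rule invertible_mat_of_trivial_kernel)
  let ?A = "inv_mat M"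
  note A = inv_mat_props[OF M inv]
  note W = window_carrier[OF A(1) i] index_window[OF A(1) i]
  show "window m ?A i \<in> carrier_mat m m" by (fact W)
  fix x assume x: "x \<in> carrier_vec m" and Wx: "window m ?A i *\<^sub>v x = 0\<^sub>v m"
  define s where "s = i - 1"
  have s: "s \<le> m" using i by (auto simp: s_def)
  define v where "v = vec (2 * m) (\<lambda>c. if s \<le> c \<and> c < s + m then x $ (c - s) else 0)"
  \<comment> \<open>The first half of \<open>u\<close> is the \<open>w\<close> of the overview. Its
    second half is the window applied to \<open>x\<close>, hence zero, so
    \<open>v = M *\<^sub>v u\<close> involves only the columns described by
    \<open>band\<close>.\<close>
  define u where "u = ?A *\<^sub>v v"
  have v: "v \<in> carrier_vec (2 * m)" by (simp add: v_def)
  have u: "u \<in> carrier_vec (2 * m)" unfolding u_def by (rule mult_mat_vec_carrier[OF A(1) v])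
  have u_bot: "u $ (m + p) = 0" if p: "p < m" for p
  proof -
    have "u $ (m + p) = (\<Sum>c<2 * m. ?A $$ (m + p, c) * (if s \<le> c \<and> c < s + m then x $ (c - s) else 0))"
      using A p by (auto simp: u_def v_def scalar_prod_def lessThan_atLeast0 intro!: sum.cong)
    also have "\<dots> = (\<Sum>q<m. ?A $$ (m + p, s + q) * x $ q)"
      by (rule sum_window[OF s])
    also have "\<dots> = (window m ?A i *\<^sub>v x) $ p"
      using W x p by (auto simp: scalar_prod_def lessThan_atLeast0 s_def intro!: sum.cong)
    finally show ?thesis using Wx p by simp
  qed
  have Mu: "M *\<^sub>v u = v"
    unfolding u_def using M A v by (simp flip: assoc_mult_mat_vec[of _ "2 * m" "2 * m" _ "2 * m"])
  have v_band: "v $ r = (\<Sum>q<m. band m d r q * u $ q)" if r: "r < 2 * m" for r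
  proof -
    have "v $ r = (\<Sum>q<2 * m. M $$ (r, q) * u $ q)"
      unfolding Mu[symmetric] using M u r by (auto simp: scalar_prod_def lessThan_atLeast0 intro!: sum.cong)
    also have "\<dots> = (\<Sum>q<m. M $$ (r, q) * u $ q)"
    proof (rule sum.mono_neutral_right)
      show "\<forall>q\<in>{..<2 * m} - {..<m}. M $$ (r, q) * u $ q = 0"
      proof
        fix q assume "q \<in> {..<2 * m} - {..<m}"
        then have "q - m < m" "m + (q - m) = q" by auto
        then show "M $$ (r, q) * u $ q = 0" using u_bot[of "q - m"] by simp
      qed
    qed auto
    finally show ?thesis using band r by simp
  qed
  have "u $ q = 0" if "q < m" for q
  \<comment> \<open>The rows \<open>r < s\<close> and \<open>m + r\<close> with
    \<open>s \<le> r\<close> are exactly those outside the window, where \<open>v\<close> vanishes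
    by construction.\<close>
  proof (rule band_kernel_trivial[OF d _ _ that, where s = s])
    show "(\<Sum>q<m. band m d r q * u $ q) = 0" if "r < s" for r
      using v_band[of r] that s by (simp add: v_def)
    show "(\<Sum>q<m. band m d (m + r) q * u $ q) = 0" if "s \<le> r" "r < m" for r
      using v_band[of "m + r"] that s by (simp add: v_def)
  qed
  then have v0: "v $ r = 0" if "r < 2 * m" for r
    using v_band[OF that] by simp
  show "x = 0\<^sub>v m"
  proof (rule eq_vecI)
    fix k assume "k < dim_vec (0\<^sub>v m)"
    then show "x $ k = 0\<^sub>v m $ k" using v0[of "s + k"] s by (simp add: v_def)
  qed (use x in simp)
qed

text \<open>Put \<open>K = inv_mat M' * M\<close>. Its first \<open>m\<close> columns are those of
  \<open>inv_mat M' * M'\<close>, so its lower left block is zero. Hence the bottom rows of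
  \<open>inv_mat M' = K * inv_mat M\<close> use only the bottom rows of \<open>inv_mat M\<close>,
  and \<open>T\<close> is the lower right block of \<open>K\<close>, the same for all
  windows.\<close>

lemma windows_left_multiple:
  assumes M: "M \<in> carrier_mat (2 * m) (2 * m)" "invertible_mat M"
    and M': "M' \<in> carrier_mat (2 * m) (2 * m)" "invertible_mat M'"
    and eq: "\<And>r q. r < 2 * m \<Longrightarrow> q < m \<Longrightarrow> M $$ (r, q) = M' $$ (r, q)"
  obtains T where "T \<in> carrier_mat m m"
    "\<And>i. i \<in> {1..m + 1} \<Longrightarrow> window m (inv_mat M') i = T * window m (inv_mat M) i"
proof -
  let ?A = "inv_mat M" and ?B = "inv_mat M'"
  note A = inv_mat_props[OF M] and B = inv_mat_props[OF M']
  define K where "K = ?B * M"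
  have K: "K \<in> carrier_mat (2 * m) (2 * m)" using B M by (simp add: K_def)
  have KA: "?B = K * ?A"
    unfolding K_def using A B M by (simp add: assoc_mult_mat[of _ "2 * m" "2 * m" _ "2 * m" _ "2 * m"])
  have K0: "K $$ (m + p, q) = 0" if "p < m" "q < m" for p q
  proof -
    have "K $$ (m + p, q) = (?B * M') $$ (m + p, q)"
      unfolding K_def using A(1) B(1) M(1) M'(1) eq that
      by (auto simp: scalar_prod_def intro!: sum.cong)
    also have "\<dots> = 0" unfolding B(3) using that by simp
    finally show ?thesis .
  qed
  define T where "T = mat m m (\<lambda>(p, k). K $$ (m + p, m + k))"
  have T: "T \<in> carrier_mat m m" by (simp add: T_def)
  moreover have "window m ?B i = T * window m ?A i" if i: "i \<in> {1..m + 1}" for i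
  proof (rule eq_matI)
    note wA = window_carrier[OF A(1) i] index_window[OF A(1) i]
    note wB = window_carrier[OF B(1) i] index_window[OF B(1) i]
    show "dim_row (window m ?B i) = dim_row (T * window m ?A i)"
      "dim_col (window m ?B i) = dim_col (T * window m ?A i)"
      using wA(1) wB(1) T by auto
    fix p q assume "p < dim_row (T * window m ?A i)" "q < dim_col (T * window m ?A i)"
    then have pq: "p < m" "q < m" using wA(1) T by auto
    let ?c = "i - 1 + q"
    have c: "?c < 2 * m" using i pq by auto
    have "window m ?B i $$ (p, q) = (K * ?A) $$ (m + p, ?c)"
      using wB(2)[OF pq] by (simp flip: KA)
    also have "\<dots> = (\<Sum>k<2 * m. K $$ (m + p, k) * ?A $$ (k, ?c))"
      using K A(1) c pq by (auto simp: scalar_prod_def lessThan_atLeast0 intro!: sum.cong)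
    also have "\<dots> = (\<Sum>k\<in>{0 + m..<m + m}. K $$ (m + p, k) * ?A $$ (k, ?c))"
      using K0 pq by (intro sum.mono_neutral_right) auto
    also have "\<dots> = (\<Sum>k<m. K $$ (m + p, m + k) * ?A $$ (m + k, ?c))"
      unfolding sum.shift_bounds_nat_ivl by (simp add: add.commute lessThan_atLeast0)
    also have "\<dots> = (T * window m ?A i) $$ (p, q)"
      using wA pq by (auto simp: T_def scalar_prod_def lessThan_atLeast0 intro!: sum.cong)
    finally show "window m ?B i $$ (p, q) = (T * window m ?A i) $$ (p, q)" .
  qed
  ultimately show thesis by (rule that)
qed

text \<open>The right blocks \<open>X\<close> and \<open>Y\<close> stay arbitrary so that
  \<open>S_mat\<close> and \<open>D_mat\<close> are both instances.\<close>

lemma toeplitz_block: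
  fixes d :: "nat \<Rightarrow> real"
  assumes "X \<in> carrier_mat m m" "Y \<in> carrier_mat m m"
  defines "M \<equiv> four_block_mat (lower_toeplitz m d) X (upper_toeplitz m d) Y"
  shows toeplitz_block_carrier: "M \<in> carrier_mat (2 * m) (2 * m)"
    and toeplitz_block_band: "\<And>r q. r < 2 * m \<Longrightarrow> q < m \<Longrightarrow> M $$ (r, q) = band m d r q"
proof -
  show "M \<in> carrier_mat (2 * m) (2 * m)"
    using assms by (auto simp: lower_toeplitz_def)
  fix r q assume rq: "r < 2 * m" "q < m"
  \<comment> \<open>Row \<open>r\<close> of the whole matrix is row \<open>r - m\<close> of the
    upper Toeplitz block; the side conditions keep the truncated subtractions exact.\<close>
  have "m + 1 - (q - (r - m)) = r - q + 1" if "m \<le> r" "r - m \<le> q"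
    using that rq by auto
  then show "M $$ (r, q) = band m d r q"
    using assms rq by (auto simp: lower_toeplitz_def upper_toeplitz_def band_def)
qed

theorem theorem1p2:
  fixes m :: nat and d n :: "nat \<Rightarrow> real"
  assumes "m \<ge> 1"
    and "\<And>k. k \<in> {1..m + 1} \<Longrightarrow> d k \<noteq> 0"
    and "\<And>k. k \<in> {1..m + 1} \<Longrightarrow> n k \<noteq> 0"
    and "invertible_mat (S_mat m d n)"
    and "invertible_mat (D_mat m d)"
  defines "A \<equiv> window m (inv_mat (D_mat m d))"
    and "B \<equiv> window m (inv_mat (S_mat m d n))"
  shows "\<forall>i\<in>{1..m + 1}. \<forall>j\<in>{1..m + 1}.
           invertible_mat (A i) \<and> invertible_mat (B j) \<and>
           inv_mat (A i) * A j = inv_mat (B i) * B j \<and>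
           A j * inv_mat (B j) = A i * inv_mat (B i)"
proof (intro ballI)
  fix i j assume ij: "i \<in> {1..m + 1}" "j \<in> {1..m + 1}"
  have "lower_toeplitz m c \<in> carrier_mat m m" "upper_toeplitz m c \<in> carrier_mat m m" for c
    by (auto simp: lower_toeplitz_def upper_toeplitz_def)
  then have D: "D_mat m d \<in> carrier_mat (2 * m) (2 * m)"
      "\<And>r q. r < 2 * m \<Longrightarrow> q < m \<Longrightarrow> D_mat m d $$ (r, q) = band m d r q"
    and S: "S_mat m d n \<in> carrier_mat (2 * m) (2 * m)"
      "\<And>r q. r < 2 * m \<Longrightarrow> q < m \<Longrightarrow> S_mat m d n $$ (r, q) = band m d r q"
    unfolding D_mat_def S_mat_def by (auto intro!: toeplitz_block)
  have d: "d 1 \<noteq> 0" "d (m + 1) \<noteq> 0" using assms(2) by auto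
  have A: "A k \<in> carrier_mat m m" "invertible_mat (A k)" if "k \<in> {1..m + 1}" for k
    unfolding A_def using window_carrier[OF inv_mat_props(1)[OF D(1) assms(5)] that]
      window_invertible[OF d D(1) assms(5) D(2) that] by blast+
  have B: "invertible_mat (B k)" if "k \<in> {1..m + 1}" for k
    unfolding B_def using window_invertible[OF d S(1) assms(4) S(2) that] by blast
  obtain T where T: "T \<in> carrier_mat m m" and BT: "\<And>k. k \<in> {1..m + 1} \<Longrightarrow> B k = T * A k"
    using windows_left_multiple[OF D(1) assms(5) S(1) assms(4)] D(2) S(2)
    unfolding A_def B_def by metis
  have TA: "invertible_mat (T * A k)" if "k \<in> {1..m + 1}" for k
    using B[OF that] BT[OF that] by simp
  \<comment> \<open>Each \<open>?P k\<close> is a left inverse of the square matrix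
    \<open>T\<close>, hence its two-sided inverse, so it cannot depend on \<open>k\<close>.\<close>
  let ?P = "\<lambda>k. A k * inv_mat (B k)"
  have PT: "?P k * T = 1\<^sub>m m" and P: "?P k \<in> carrier_mat m m" if k: "k \<in> {1..m + 1}" for k
    using left_multiple_quotients(2)[OF T A(1)[OF k] A(1)[OF k] A(2)[OF k] TA[OF k]]
      inv_mat_props(1)[OF mult_carrier_mat[OF T A(1)[OF k]] TA[OF k]] A(1)[OF k] BT[OF k]
    by auto
  have TP: "T * ?P i = 1\<^sub>m m"
    using mat_mult_left_right_inverse[OF P[OF ij(1)] T PT[OF ij(1)]] .
  have "?P j = ?P j * (T * ?P i)"
    unfolding TP by (rule right_mult_one_mat[OF P[OF ij(2)], symmetric])
  also have "\<dots> = ?P i"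
    unfolding assoc_mult_mat[OF P[OF ij(2)] T P[OF ij(1)], symmetric] PT[OF ij(2)]
    by (rule left_mult_one_mat[OF P[OF ij(1)]])
  finally have "?P j = ?P i" .
  moreover have "inv_mat (A i) * A j = inv_mat (B i) * B j"
    using left_multiple_quotients(1)[OF T A(1)[OF ij(1)] A(1)[OF ij(2)] A(2)[OF ij(1)] TA[OF ij(1)]]
      BT ij by simp
  ultimately show "invertible_mat (A i) \<and> invertible_mat (B j) \<and>
      inv_mat (A i) * A j = inv_mat (B i) * B j \<and> ?P j = ?P i"
    using A B ij by blast
qed

end
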